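(* For every positive integer $k$, the class $\mathcal{LEQ}_k$ of all finite labelled $k$-equivalences (with their embeddings) is a Ramsey class.
   Context: For a set $A$, $\binom{A}{k}$ denotes the set of all $k$-element subsets of $A$, and $\mathbb N$ carries its usual order. Labelled $k$-equivalence: a linearly ordered set $(A,\leq_{\mathbf A})$ together with a mapping $\ell_{\mathbf A}:\binom{A}{k}\to\mathbb N$ (the labelling). It is tacitly assumed that $A$ and $\mathbb N$ are disjoint. $\mathrm{Rg}(\ell_{\mathbf A})$ denotes the range of $\ell_{\mathbf A}$. It is finite if $A$ is finite. Embedding: given labelled $k$-equivalences $\mathbf A$ and $\mathbf B$, a mapping $f:A\to B$ is an embedding if $f$ is a monotone (order-preserving) injection and there is a monotone injective map $\iota:\mathrm{Rg}(\ell_{\mathbf A})\to\mathrm{Rg}(\ell_{\mathbf B})$ such that $\iota(\ell_{\mathbf A}(M))=\ell_{\mathbf B}(f(M))$ for every $M\in\binom{A}{k}$. (Thus both equality of labels and the order of labels are preserved and reflected.) Copies: for an embedding $f:\mathbf A\to\mathbf B$, the image $f(A)$, with the order and labelling restricted from $\mathbf B$, is called a copy of $\mathbf A$ in $\mathbf B$. $\binom{\mathbf B}{\mathbf A}$ denotes the set of all copies of $\mathbf A$ in $\mathbf B$. Ramsey class: a class $\mathcal K$ of structures with embeddings is a Ramsey class if for all $\mathbf A,\mathbf B\in\mathcal K$ and every positive integer $r$ there exists $\mathbf C\in\mathcal K$ such that for every partition of $\binom{\mathbf C}{\mathbf A}$ into $r$ classes there is $\widetilde{\mathbf B}\in\binom{\mathbf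 C}{\mathbf B}$ such that $\binom{\widetilde{\mathbf B}}{\mathbf A}$ is contained in one class of the partition. *)

theory Defs
  imports "HOL-Library.Ramsey" "HOL-Library.Disjoint_Sets" "HOL-Library.Infinite_Typeclass"
begin

record 'a lequiv =
  carrier :: "'a set"
  ordering :: "'a rel"
  label :: "'a set \<Rightarrow> nat"

text \<open>
  The set \<open>[A]\<^bsup>k\<^esup>\<close> (\<^const>\<open>nsets\<close>) is the set of \<open>k\<close>-element subsets of \<open>A\<close>. The labelling is made
  \<^const>\<open>undefined\<close> off \<open>[A]\<^bsup>k\<^esup>\<close>, so that equality of records is equality of structures; this matters
  because copies are collected in a set.
\<close>

definition labelled_equiv :: "nat \<Rightarrow> 'a lequiv \<Rightarrow> bool" where
  "labelled_equiv k A \<longleftrightarrow>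
     linear_order_on (carrier A) (ordering A) \<and>
     label A \<in> nsets (carrier A) k \<rightarrow>\<^sub>E UNIV"

definition LEQ :: "nat \<Rightarrow> 'a lequiv set" where
  "LEQ k = {A. labelled_equiv k A \<and> finite (carrier A)}"

definition label_range :: "nat \<Rightarrow> 'a lequiv \<Rightarrow> nat set" where
  "label_range k A = label A ` nsets (carrier A) k"

definition embedding :: "nat \<Rightarrow> 'a lequiv \<Rightarrow> 'b lequiv \<Rightarrow> ('a \<Rightarrow> 'b) \<Rightarrow> bool" where
  "embedding k A B f \<longleftrightarrow>
     f \<in> carrier A \<rightarrow> carrier B \<and>
     inj_on f (carrier A) \<and>
     (\<forall>x\<in>carrier A. \<forall>y\<in>carrier A. (x, y) \<in> ordering A \<longrightarrow> (f x, f y) \<in> ordering B) \<and>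
     (\<exists>\<iota>. \<iota> \<in> label_range k A \<rightarrow> label_range k B \<and>
          inj_on \<iota> (label_range k A) \<and>
          mono_on (label_range k A) \<iota> \<and>
          (\<forall>M\<in>nsets (carrier A) k. \<iota> (label A M) = label B (f ` M)))"

definition substructure :: "nat \<Rightarrow> 'a lequiv \<Rightarrow> 'a set \<Rightarrow> 'a lequiv" where
  "substructure k B S =
     \<lparr>carrier = S, ordering = ordering B \<inter> S \<times> S, label = restrict (label B) (nsets S k)\<rparr>"

definition copies :: "nat \<Rightarrow> 'b lequiv \<Rightarrow> 'a lequiv \<Rightarrow> 'b lequiv set" where
  "copies k B A = {substructure k B (f ` carrier A) | f. embedding k A B f}"

text \<open>
  The class \<open>K\<close> and its embeddings enter through \<open>cp\<close>, where \<open>cp C A\<close> is the set of copies of \<open>A\<close>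
  in \<open>C\<close>. A partition into \<open>r\<close> classes is an indexed disjoint family \<open>P 0, \<dots>, P (r - 1)\<close> covering
  \<open>cp C A\<close>, some members of which may be empty (i.e. an \<open>r\<close>-colouring).
\<close>

definition ramsey_class :: "('s \<Rightarrow> 's \<Rightarrow> 's set) \<Rightarrow> 's set \<Rightarrow> bool" where
  "ramsey_class cp K \<longleftrightarrow>
     (\<forall>A\<in>K. \<forall>B\<in>K. \<forall>r::nat. r > 0 \<longrightarrow>
        (\<exists>C\<in>K. \<forall>P :: nat \<Rightarrow> 's set.
           disjoint_family_on P {..<r} \<and> (\<Union>i<r. P i) = cp C A \<longrightarrow>
           (\<exists>B'\<in>cp C B. \<exists>i<r. cp B' A \<subseteq> P i)))"

end

theory Submission
  imports Defs "HOL-Library.Countable"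
begin

text \<open>
  Labels can be kept fixed: by the product version of Ramsey's theorem choose a vertex set
  \<open>{..<N}\<close> and a label set \<open>{..<L}\<close> for the cardinalities at hand. Every structure transported
  to a vertex set \<open>\<alpha> \<subseteq> {..<N}\<close> and a label set \<open>\<delta> \<subseteq> {..<L}\<close> becomes a complete
  \<open>k\<close>-uniform hypergraph with its edges coloured by actual numbers, and it remains to find a
  partite system, over the parts \<open>0, \<dots>, N - 1\<close>, in which the colour of a copy of \<open>A\<close> depends
  only on the pair \<open>(\<alpha>, \<delta>)\<close>. This is the partite construction of Nesetril and Rodl: start with a disjoint union
  of all transported \<open>B\<close>, and treat the pairs \<open>(\<alpha>, \<delta>)\<close> one after the other, each by a
  Hales-Jewett power over the alphabet of all copies of \<open>A\<close> with that index.
  No label needs to be identified or duplicated on the way, since labels are preserved exactly.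
  A vertex is a pair whose first component is its part; lexicographic order makes every
  transversal embedding monotone.
\<close>

section \<open>The Hales-Jewett theorem\<close>

text \<open>\<open>None\<close> marks a moving coordinate, of which there is at least one;
  \<open>Some i\<close> fixes a coordinate to the letter \<open>i\<close>.\<close>

definition combinatorial_line :: "nat \<Rightarrow> nat \<Rightarrow> nat option list \<Rightarrow> bool" where
  "combinatorial_line t N W \<longleftrightarrow>
     length W = N \<and> set W \<subseteq> insert None (Some ` {..<t}) \<and> None \<in> set W"

definition line_point :: "nat option list \<Rightarrow> nat \<Rightarrow> nat list" where
  "line_point W j = map (\<lambda>z. case z of None \<Rightarrow> j | Some i \<Rightarrow> i) W"

lemma line_point_append [simp]: "line_point (V @ W) j = line_point V j @ line_point W j"
  by (simp add: line_point_def)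

lemma line_point_constant [simp]: "line_point (map Some x) j = x"
  by (simp add: line_point_def comp_def)

lemma line_point_lists:
  assumes "combinatorial_line t N W" "j < t'" "t \<le> t'"
  shows "set (line_point W j) \<subseteq> {..<t'} \<and> length (line_point W j) = N"
  using assms by (fastforce simp: combinatorial_line_def line_point_def split: option.splits)

lemma finite_combinatorial_lines: "finite {W. combinatorial_line t N W}"
proof (rule finite_subset)
  show "{W. combinatorial_line t N W} \<subseteq> {W. set W \<subseteq> insert None (Some ` {..<t}) \<and> length W = N}"
    by (auto simp: combinatorial_line_def)
qed (simp add: finite_lists_length_eq)

text \<open>Colourings are total on lists and colours are numbers, so that tuples of colours can
  serve as colours again after \<open>to_nat\<close>.\<close>

definition hales_jewett_dim :: "nat \<Rightarrow> nat set \<Rightarrow> nat \<Rightarrow> bool" where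
  "hales_jewett_dim t Q N \<longleftrightarrow>
     (\<forall>\<chi>. (\<forall>x. \<chi> x \<in> Q) \<longrightarrow>
        (\<exists>W c. combinatorial_line t N W \<and> (\<forall>j<t. \<chi> (line_point W j) = c)))"

text \<open>
  Colour focusing: \<open>f\<close> is the common last point of lines over the alphabet \<open>{..t}\<close> which, without
  that point, are monochromatic in pairwise different colours (the set \<open>C\<close>).
\<close>

definition focused :: "nat \<Rightarrow> nat set \<Rightarrow> nat \<Rightarrow> nat \<Rightarrow> bool" where
  "focused t Q s N \<longleftrightarrow>
     (\<forall>\<chi>. (\<forall>x. \<chi> x \<in> Q) \<longrightarrow>
        (\<exists>W c. combinatorial_line (Suc t) N W \<and> (\<forall>j<Suc t. \<chi> (line_point W j) = c)) \<or>
        (\<exists>f C. C \<subseteq> Q \<and> card C = s \<and> length f = N \<and> set f \<subseteq> {..<Suc t} \<and>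
           (\<forall>c\<in>C. \<exists>W. combinatorial_line (Suc t) N W \<and> line_point W t = f \<and>
               (\<forall>j<t. \<chi> (line_point W j) = c))))"

text \<open>Prefix \<open>M\<close> coordinates containing a line \<open>L\<close> along which, for
  letters below \<open>t\<close>, the colour pattern on all words of length \<open>N\<close> is
  constant. Old focused lines are run in parallel with \<open>L\<close>; holding the old focus
  \<open>f\<close> fixed while \<open>L\<close> moves gives a line in one further colour. All of
  them share the focus \<open>line_point L t @ f\<close>.\<close>

lemma focused_step:
  assumes t: "t > 0" and Q: "finite Q"
    and hj: "\<And>Q. finite Q \<Longrightarrow> \<exists>N. hales_jewett_dim t Q N"
    and foc: "focused t Q s N"
  shows "\<exists>N'. focused t Q (Suc s) N'"
proof -
  define Y where "Y = {y. set y \<subseteq> {..<Suc t} \<and> length y = N}"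
  have "finite Y"
    unfolding Y_def by (rule finite_lists_length_eq) simp
  then obtain ys where ys: "set ys = Y"
    using finite_list by blast
  \<comment> \<open>A colour in \<open>Q'\<close> encodes a colouring of all words of length
    \<open>N\<close> over the larger alphabet.\<close>
  define Q' where "Q' = to_nat ` {l. set l \<subseteq> Q \<and> length l = length ys}"
  have "finite Q'"
    unfolding Q'_def using Q by (intro finite_imageI finite_lists_length_eq)
  then obtain M where M: "hales_jewett_dim t Q' M"
    using hj by blast
  have "focused t Q (Suc s) (M + N)"
    unfolding focused_def
  proof (intro allI impI)
    fix \<chi> :: "nat list \<Rightarrow> nat" assume \<chi>: "\<forall>x. \<chi> x \<in> Q"
    define \<chi>' where "\<chi>' x = to_nat (map (\<lambda>y. \<chi> (x @ y)) ys)" for x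
    have "\<forall>x. \<chi>' x \<in> Q'"
      unfolding \<chi>'_def Q'_def using \<chi> by (intro allI imageI) auto
    then obtain L c where L: "combinatorial_line t M L" "\<forall>j<t. \<chi>' (line_point L j) = c"
      using M unfolding hales_jewett_dim_def by blast
    have L_const: "\<chi> (line_point L j @ y) = \<chi> (line_point L 0 @ y)" if "j < t" "y \<in> Y" for j y
    proof -
      have "\<chi>' (line_point L j) = \<chi>' (line_point L 0)"
        using L(2) t that(1) by simp
      then show ?thesis
        using that(2) by (simp add: \<chi>'_def ys)
    qed
    \<comment> \<open>By \<open>L_const\<close> the letter 0 represents every letter below
      \<open>t\<close>.\<close>
    define \<chi>2 where "\<chi>2 y = \<chi> (line_point L 0 @ y)" for y
    have L': "combinatorial_line (Suc t) M L"
      using L(1) by (force simp: combinatorial_line_def)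
    have Wt: "combinatorial_line (Suc t) (M + N) (map Some (line_point L 0) @ W)"
      if "combinatorial_line (Suc t) N W" for W
      using that line_point_lists[OF L(1) t] by (auto simp: combinatorial_line_def)
    let ?mono = "\<lambda>N \<chi>. \<exists>W c. combinatorial_line (Suc t) N W \<and> (\<forall>j<Suc t. \<chi> (line_point W j) = c)"
    have lift: "?mono (M + N) \<chi>" if "?mono N \<chi>2"
    proof -
      from that obtain W c where "combinatorial_line (Suc t) N W" "\<forall>j<Suc t. \<chi>2 (line_point W j) = c"
        by blast
      with Wt show ?thesis
        by (intro exI[of _ "map Some (line_point L 0) @ W"] exI[of _ c]) (auto simp: \<chi>2_def)
    qed
    have "\<forall>x. \<chi>2 x \<in> Q"
      using \<chi> by (simp add: \<chi>2_def)
    from foc[unfolded focused_def, THEN spec, THEN mp, OF this] consider "?mono N \<chi>2" |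
      f C where "C \<subseteq> Q" "card C = s" "length f = N" "set f \<subseteq> {..<Suc t}"
         "\<forall>c\<in>C. \<exists>W. combinatorial_line (Suc t) N W \<and> line_point W t = f \<and>
             (\<forall>j<t. \<chi>2 (line_point W j) = c)"
      by blast
    then show "?mono (M + N) \<chi> \<or>
        (\<exists>f C. C \<subseteq> Q \<and> card C = Suc s \<and> length f = M + N \<and> set f \<subseteq> {..<Suc t} \<and>
           (\<forall>c\<in>C. \<exists>W. combinatorial_line (Suc t) (M + N) W \<and> line_point W t = f \<and>
               (\<forall>j<t. \<chi> (line_point W j) = c)))"
    proof cases
      case 1
      then show ?thesis using lift by blast
    next
      case 2
      show ?thesis
      proof (cases "\<chi>2 f \<in> C")
        case True
        \<comment> \<open>The focus completes the line of its own colour to a monochromatic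
          one.\<close>
        with 2(5) obtain W where W: "combinatorial_line (Suc t) N W" "line_point W t = f"
            "\<forall>j<t. \<chi>2 (line_point W j) = \<chi>2 f"
          by blast
        then have "\<forall>j<Suc t. \<chi>2 (line_point W j) = \<chi>2 f"
          by (simp add: less_Suc_eq)
        with W(1) lift show ?thesis by blast
      next
        case False
        have fY: "f \<in> Y" using 2 by (simp add: Y_def)
        have "\<exists>W. combinatorial_line (Suc t) (M + N) W \<and> line_point W t = line_point L t @ f \<and>
               (\<forall>j<t. \<chi> (line_point W j) = c)" if c: "c \<in> insert (\<chi>2 f) C" for c
        proof (cases "c = \<chi>2 f")
          case True
          have "combinatorial_line (Suc t) (M + N) (L @ map Some f)"
            using L' 2(3,4) by (auto simp: combinatorial_line_def)
          moreover have "\<chi> (line_point (L @ map Some f) j) = c" if "j < t" for j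
            using L_const[OF that fY] True by (simp add: \<chi>2_def)
          moreover have "line_point (L @ map Some f) t = line_point L t @ f"
            by simp
          ultimately show ?thesis by blast
        next
          case False
          with c 2(5) obtain W where W: "combinatorial_line (Suc t) N W" "line_point W t = f"
            "\<forall>j<t. \<chi>2 (line_point W j) = c"
            by blast
          have "combinatorial_line (Suc t) (M + N) (L @ W)"
            using L' W(1) by (auto simp: combinatorial_line_def)
          moreover have "\<chi> (line_point (L @ W) j) = c" if "j < t" for j
          proof -
            have "line_point W j \<in> Y"
              using line_point_lists[OF W(1), of j "Suc t"] that by (simp add: Y_def)
            then show ?thesis
              using L_const[OF that] W(3) that by (simp add: \<chi>2_def)
          qed
          moreover have "line_point (L @ W) t = line_point L t @ f"
            using W(2) by simp
          ultimately show ?thesis by blast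
        qed
        moreover have "card (insert (\<chi>2 f) C) = Suc s"
          using False 2(1,2) Q finite_subset by (metis card_insert_disjoint)
        moreover have "insert (\<chi>2 f) C \<subseteq> Q"
          using 2(1) \<chi> by (simp add: \<chi>2_def)
        moreover have "length (line_point L t @ f) = M + N \<and> set (line_point L t @ f) \<subseteq> {..<Suc t}"
          using line_point_lists[OF L', of t "Suc t"] 2(3,4) by simp
        ultimately show ?thesis by blast
      qed
    qed
  qed
  then show ?thesis ..
qed

text \<open>Induction on the size of the alphabet. Once \<open>card Q\<close> lines are focused,
  every colour occurs among them, so the focus completes the line that has its colour.\<close>

theorem hales_jewett:
  assumes "t > 0" "finite Q"
  shows "\<exists>N. hales_jewett_dim t Q N"
  using assms
proof (induction t arbitrary: Q)
  case (Suc t)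
  note IH = Suc.IH and prems = Suc.prems
  show ?case
  proof (cases "t = 0")
    case True
    have "hales_jewett_dim (Suc t) Q 1"
      using True by (auto simp: hales_jewett_dim_def combinatorial_line_def intro!: exI[of _ "[None]"])
    then show ?thesis ..
  next
    case False
    have "\<exists>N. focused t Q s N" for s
    proof (induction s)
      case 0
      have "focused t Q 0 0"
        by (auto simp: focused_def)
      then show ?case ..
    next
      case (Suc s)
      then obtain N where "focused t Q s N" ..
      moreover have "t > 0" using False by simp
      ultimately show ?case
        using focused_step prems(2) IH by blast
    qed
    then obtain N where N: "focused t Q (card Q) N" by blast
    have "hales_jewett_dim (Suc t) Q N"
      unfolding hales_jewett_dim_def
    proof (intro allI impI)
      fix \<chi> :: "nat list \<Rightarrow> nat" assume \<chi>: "\<forall>x. \<chi> x \<in> Q"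
      from N[unfolded focused_def, THEN spec, THEN mp, OF \<chi>] consider "\<exists>W c. combinatorial_line (Suc t) N W \<and> (\<forall>j<Suc t. \<chi> (line_point W j) = c)" |
        f C where "C \<subseteq> Q" "card C = card Q"
          "\<forall>c\<in>C. \<exists>W. combinatorial_line (Suc t) N W \<and> line_point W t = f \<and>
             (\<forall>j<t. \<chi> (line_point W j) = c)"
        by blast
      then show "\<exists>W c. combinatorial_line (Suc t) N W \<and> (\<forall>j<Suc t. \<chi> (line_point W j) = c)"
      proof cases
        case 2
        then have "C = Q"
          using prems(2) card_subset_eq by blast
        then have "\<chi> f \<in> C" using \<chi> by simp
        with 2(3) obtain W where "combinatorial_line (Suc t) N W" "line_point W t = f"
             "\<forall>j<t. \<chi> (line_point W j) = \<chi> f"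
          by blast
        then show ?thesis
          by (intro exI[of _ W] exI[of _ "\<chi> f"]) (auto simp: less_Suc_eq)
      qed
    qed
    then show ?thesis ..
  qed
qed simp

section \<open>The partite construction\<close>

text \<open>The graph of \<open>u\<close> over \<open>T\<close>, with one vertex in each part. A
  copy is thus handled as a function choosing a vertex from every part.\<close>

definition transversal :: "(nat \<Rightarrow> nat) \<Rightarrow> nat set \<Rightarrow> (nat \<times> nat) set" where
  "transversal u T = (\<lambda>p. (p, u p)) ` T"

lemma fst_transversal [simp]: "fst ` transversal u T = T"
  by (force simp: transversal_def)

lemma transversal_cong: "(\<And>p. p \<in> T \<Longrightarrow> u p = v p) \<Longrightarrow> transversal u T = transversal v T"
  by (auto simp: transversal_def)

lemma transversal_eqD:
  assumes "transversal u T = transversal v T'"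
  shows "T = T'" "p \<in> T \<Longrightarrow> u p = v p"
proof -
  show "T = T'" using assms fst_transversal by metis
  show "u p = v p" if "p \<in> T"
  proof -
    have "(p, u p) \<in> transversal v T'" using that assms by (auto simp: transversal_def)
    then show ?thesis by (auto simp: transversal_def)
  qed
qed

definition partite_copy ::
  "nat \<Rightarrow> (nat \<times> nat) set \<Rightarrow> ((nat \<times> nat) set \<Rightarrow> nat) \<Rightarrow> nat set \<Rightarrow> (nat set \<Rightarrow> nat) \<Rightarrow> (nat \<Rightarrow> nat) \<Rightarrow> bool"
where
  "partite_copy k V l \<alpha> m u \<longleftrightarrow>
     (\<forall>p\<in>\<alpha>. (p, u p) \<in> V) \<and> (\<forall>T\<in>nsets \<alpha> k. l (transversal u T) = m T)"

text \<open>Each part is mapped to itself, so such a map is automatically injective on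
  transversals.\<close>

definition partite_emb ::
  "nat \<Rightarrow> (nat \<times> nat) set \<Rightarrow> ((nat \<times> nat) set \<Rightarrow> nat) \<Rightarrow>
     (nat \<times> nat) set \<Rightarrow> ((nat \<times> nat) set \<Rightarrow> nat) \<Rightarrow> (nat \<Rightarrow> nat \<Rightarrow> nat) \<Rightarrow> bool"
where
  "partite_emb k V l V' l' F \<longleftrightarrow>
     (\<forall>p y. (p, y) \<in> V \<longrightarrow> (p, F p y) \<in> V') \<and>
     (\<forall>T u. finite T \<and> card T = k \<and> (\<forall>p\<in>T. (p, u p) \<in> V) \<longrightarrow>
        l' (transversal (\<lambda>p. F p (u p)) T) = l (transversal u T))"

lemma partite_emb_id: "partite_emb k V l V l (\<lambda>p y. y)"
  by (simp add: partite_emb_def)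

lemma partite_emb_comp:
  assumes "partite_emb k V l V' l' F" "partite_emb k V' l' V'' l'' G"
  shows "partite_emb k V l V'' l'' (\<lambda>p y. G p (F p y))"
  unfolding partite_emb_def
proof (intro conjI allI impI)
  show "(p, G p (F p y)) \<in> V''" if "(p, y) \<in> V" for p y
    using assms that by (auto simp: partite_emb_def)
  fix T u assume T: "finite T \<and> card T = k \<and> (\<forall>p\<in>T. (p, u p) \<in> V)"
  then have "l' (transversal (\<lambda>p. F p (u p)) T) = l (transversal u T)"
    using assms(1) by (auto simp: partite_emb_def)
  moreover have "\<forall>p\<in>T. (p, F p (u p)) \<in> V'"
    using assms(1) T by (auto simp: partite_emb_def)
  then have "l'' (transversal (\<lambda>p. G p (F p (u p))) T) = l' (transversal (\<lambda>p. F p (u p)) T)"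
    using assms(2)[unfolded partite_emb_def, THEN conjunct2, THEN spec, THEN spec,
        of T "\<lambda>p. F p (u p)"] T by simp
  ultimately show "l'' (transversal (\<lambda>p. G p (F p (u p))) T) = l (transversal u T)"
    by simp
qed

text \<open>Both directions matter: copies are pushed into larger systems, and a copy of
  \<open>A\<close> lying in the image of a copy of \<open>B\<close> is pulled back to the initial
  system, to which the statements on colours refer.\<close>

lemma partite_copy_emb_iff:
  assumes "\<forall>p\<in>\<alpha>. (p, u p) \<in> V" "partite_emb k V l V' l' F"
  shows "partite_copy k V' l' \<alpha> m (\<lambda>p. F p (u p)) \<longleftrightarrow> partite_copy k V l \<alpha> m u"
proof -
  have "l' (transversal (\<lambda>p. F p (u p)) T) = l (transversal u T)" if "T \<in> nsets \<alpha> k" for T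
  proof -
    have "finite T \<and> card T = k \<and> (\<forall>p\<in>T. (p, u p) \<in> V)"
      using that assms(1) by (auto simp: nsets_def)
    then show ?thesis
      using assms(2) by (simp add: partite_emb_def)
  qed
  then show ?thesis
    using assms by (auto simp: partite_copy_def partite_emb_def)
qed

lemma partite_copy_emb:
  assumes "partite_copy k V l \<alpha> m u" "partite_emb k V l V' l' F"
  shows "partite_copy k V' l' \<alpha> m (\<lambda>p. F p (u p))"
proof -
  have "\<forall>p\<in>\<alpha>. (p, u p) \<in> V" using assms(1) by (simp add: partite_copy_def)
  then show ?thesis using partite_copy_emb_iff assms by blast
qed

text \<open>
  A line \<open>W\<close> over the alphabet of copies \<open>e\<close> of the small structure above \<open>\<alpha>\<close> embeds a partite
  system: a vertex above \<open>\<alpha>\<close> becomes a word, and any other vertex is tagged with \<open>W\<close>, so that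
  the images under different lines are amalgamated freely outside \<open>\<alpha>\<close>.
\<close>

definition line_vertex :: "nat set \<Rightarrow> (nat \<Rightarrow> nat \<Rightarrow> nat) \<Rightarrow> nat option list \<Rightarrow> nat \<Rightarrow> nat \<Rightarrow> nat" where
  "line_vertex \<alpha> e W p y =
     to_nat (if p \<in> \<alpha> then Inl (map (\<lambda>z. case z of None \<Rightarrow> y | Some i \<Rightarrow> e i p) W)
             else Inr (W, y) :: nat list + nat option list \<times> nat)"

lemma line_vertex_eq_inside:
  assumes "line_vertex \<alpha> e W p y = line_vertex \<alpha> e W' p y'" "p \<in> \<alpha>" "j < length W" "W ! j = None"
  shows "j < length W'" "y = (case W' ! j of None \<Rightarrow> y' | Some i \<Rightarrow> e i p)"
proof -
  have *: "map (\<lambda>z. case z of None \<Rightarrow> y | Some i \<Rightarrow> e i p) W =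
        map (\<lambda>z. case z of None \<Rightarrow> y' | Some i \<Rightarrow> e i p) W'"
    using assms by (simp add: line_vertex_def)
  then show j: "j < length W'"
    using assms(3) by (metis length_map)
  have "map (\<lambda>z. case z of None \<Rightarrow> y | Some i \<Rightarrow> e i p) W ! j =
        map (\<lambda>z. case z of None \<Rightarrow> y' | Some i \<Rightarrow> e i p) W' ! j"
    using * by simp
  then show "y = (case W' ! j of None \<Rightarrow> y' | Some i \<Rightarrow> e i p)"
    using assms(3,4) j by simp
qed

lemma line_vertex_eq_outside:
  assumes "line_vertex \<alpha> e W p y = line_vertex \<alpha> e W' p y'" "p \<notin> \<alpha>"
  shows "W = W'" "y = y'"
  using assms by (simp_all add: line_vertex_def)

text \<open>
  If the two images of a \<open>k\<close>-set agree, then at a moving coordinate of one line the other line either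
  moves too, so that the two \<open>k\<close>-sets coincide, or shows a \<open>k\<close>-set of a copy, whose label is
  prescribed by \<open>m\<close>.
\<close>

lemma line_vertex_label_unique:
  assumes e: "\<And>i. i < t \<Longrightarrow> partite_copy k V l \<alpha> m (e i)"
    and W: "combinatorial_line t N W" and W': "combinatorial_line t N W'"
    and T: "finite T" "card T = k"
    and eq: "\<And>p. p \<in> T \<Longrightarrow> line_vertex \<alpha> e W p (u p) = line_vertex \<alpha> e W' p (u' p)"
  shows "l (transversal u T) = l (transversal u' T)"
proof -
  have one: "transversal u T = transversal u' T \<or> T \<subseteq> \<alpha> \<and> l (transversal u T) = m T"
    if W: "combinatorial_line t N W" and W': "combinatorial_line t N W'"
      and eq: "\<And>p. p \<in> T \<Longrightarrow> line_vertex \<alpha> e W p (u p) = line_vertex \<alpha> e W' p (u' p)"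
    for W W' u u'
  proof -
    obtain j where j: "j < length W" "W ! j = None"
      using W by (metis combinatorial_line_def in_set_conv_nth)
    have lenW': "length W' = length W"
      using W W' by (simp add: combinatorial_line_def)
    show ?thesis
    proof (cases "W' ! j")
      case None
      have "u p = u' p" if "p \<in> T" for p
        using line_vertex_eq_inside(2)[OF eq[OF that] _ j] line_vertex_eq_outside(2)[OF eq[OF that]] None
        by fastforce
      then show ?thesis using transversal_cong by blast
    next
      case (Some i)
      have "W \<noteq> W'" using Some j by auto
      then have sub: "T \<subseteq> \<alpha>"
        using eq line_vertex_eq_outside(1) by blast
      have "Some i \<in> set W'"
        using Some j lenW' by (metis nth_mem)
      then have i: "i < t" using W' by (auto simp: combinatorial_line_def)
      have "u p = e i p" if "p \<in> T" for p
        using line_vertex_eq_inside(2)[OF eq[OF that] _ j] Some sub that by auto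
      then have "transversal u T = transversal (e i) T"
        by (rule transversal_cong)
      moreover have "T \<in> nsets \<alpha> k" using sub T by (simp add: nsets_def)
      ultimately show ?thesis
        using e[OF i] sub by (simp add: partite_copy_def)
    qed
  qed
  \<comment> \<open>\<open>one\<close> treats its two lines asymmetrically, reading a moving
    coordinate of the first. Swapping them gives the label \<open>m T\<close> on the other side as
    well.\<close>
  show ?thesis
    using one[OF W W' eq] one[OF W' W, of u' u] eq by metis
qed

text \<open>The letters are the copies above \<alpha>, and \<open>V'\<close> is the union of the
  images of \<open>V\<close> under all lines. A colouring of transversals above \<alpha> induces one
  of words; a monochromatic line embeds \<open>V\<close> so that all its copies above \<alpha> get
  the same colour.\<close>

lemma partite_lemma:
  assumes V: "finite V" and \<alpha>: "finite \<alpha>" and Q: "finite (Q :: nat set)"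
  shows "\<exists>V' l'. finite V' \<and>
    (\<forall>\<chi>. (\<forall>S. \<chi> S \<in> Q) \<longrightarrow>
      (\<exists>F. partite_emb k V l V' l' F \<and>
        (\<exists>c\<in>Q. \<forall>u. partite_copy k V l \<alpha> m u \<longrightarrow> \<chi> (transversal (\<lambda>p. F p (u p)) \<alpha>) = c)))"
proof (cases "\<exists>u. partite_copy k V l \<alpha> m u")
  case False
  \<comment> \<open>Without copies only some \<open>c \<in> Q\<close> is asked for, and any value of
    \<chi> provides it.\<close>
  then have "\<forall>\<chi>. (\<forall>S. \<chi> S \<in> Q) \<longrightarrow>
      (\<exists>F. partite_emb k V l V l F \<and>
        (\<exists>c\<in>Q. \<forall>u. partite_copy k V l \<alpha> m u \<longrightarrow> \<chi> (transversal (\<lambda>p. F p (u p)) \<alpha>) = c))"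
    using partite_emb_id by blast
  then show ?thesis using V by blast
next
  case True
  \<comment> \<open>Restriction to \<open>extensional\<close> functions makes the alphabet
    finite.\<close>
  define E where "E = {u \<in> extensional \<alpha>. partite_copy k V l \<alpha> m u}"
  have copy_restrict: "restrict u \<alpha> \<in> E" if "partite_copy k V l \<alpha> m u" for u
  proof -
    have "transversal (restrict u \<alpha>) T = transversal u T" if "T \<in> nsets \<alpha> k" for T
      using that by (intro transversal_cong) (auto simp: nsets_def)
    then show ?thesis
      using that by (simp add: E_def partite_copy_def)
  qed
  have "E \<subseteq> \<alpha> \<rightarrow>\<^sub>E snd ` V"
    by (force simp: E_def partite_copy_def PiE_def)
  then have "finite E"
    using V \<alpha> by (meson finite_PiE finite_imageI finite_subset)
  define t where "t = card E"
  have t: "t > 0"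
    unfolding t_def using True copy_restrict \<open>finite E\<close> by (auto simp: card_gt_0_iff)
  obtain e where "bij_betw e {..<t} E"
    unfolding t_def using \<open>finite E\<close> ex_bij_betw_nat_finite by (metis atLeast0LessThan)
  then have eE: "e ` {..<t} = E"
    by (simp add: bij_betw_def)
  then have e: "partite_copy k V l \<alpha> m (e i)" if "i < t" for i
    using that by (auto simp: E_def)
  obtain N where N: "hales_jewett_dim t Q N"
    using hales_jewett[OF t Q] by blast
  define Ls where "Ls = {W. combinatorial_line t N W}"
  define V' where "V' = (\<lambda>(W, p, y). (p, line_vertex \<alpha> e W p y)) ` (Ls \<times> V)"
  define is_label where "is_label S c \<longleftrightarrow>
     (\<exists>W\<in>Ls. \<exists>T u. finite T \<and> card T = k \<and> (\<forall>p\<in>T. (p, u p) \<in> V) \<and>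
        S = transversal (\<lambda>p. line_vertex \<alpha> e W p (u p)) T \<and> c = l (transversal u T))" for S c
  \<comment> \<open>A \<open>k\<close>-set may lie in the images of several lines;
    \<open>line_vertex_label_unique\<close> makes the choice of its label unambiguous.\<close>
  define l' where "l' S = (SOME c. is_label S c)" for S
  have unique: "c = c'" if "is_label S c" "is_label S c'" for S c c'
  proof -
    from that(1) obtain W T u where 1: "W \<in> Ls" "finite T" "card T = k"
        "S = transversal (\<lambda>p. line_vertex \<alpha> e W p (u p)) T" "c = l (transversal u T)"
      unfolding is_label_def by blast
    from that(2) obtain W' T' u' where 2: "W' \<in> Ls"
        "S = transversal (\<lambda>p. line_vertex \<alpha> e W' p (u' p)) T'" "c' = l (transversal u' T')"
      unfolding is_label_def by blast
    note eq = transversal_eqD[OF 1(4)[unfolded 2(2)], symmetric]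
    show ?thesis
      using line_vertex_label_unique[of t k V l \<alpha> m e N W W' T u u'] e 1 2 eq
      by (simp add: Ls_def)
  qed
  have emb: "partite_emb k V l V' l' (line_vertex \<alpha> e W)" if W: "W \<in> Ls" for W
    unfolding partite_emb_def
  proof (intro conjI allI impI)
    show "(p, line_vertex \<alpha> e W p y) \<in> V'" if "(p, y) \<in> V" for p y
      using that W by (force simp: V'_def)
    fix T u assume "finite T \<and> card T = k \<and> (\<forall>p\<in>T. (p, u p) \<in> V)"
    then have "is_label (transversal (\<lambda>p. line_vertex \<alpha> e W p (u p)) T) (l (transversal u T))"
      unfolding is_label_def using W by blast
    then show "l' (transversal (\<lambda>p. line_vertex \<alpha> e W p (u p)) T) = l (transversal u T)"
      unfolding l'_def using unique by blast
  qed
  have "\<exists>F. partite_emb k V l V' l' F \<and>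
        (\<exists>c\<in>Q. \<forall>u. partite_copy k V l \<alpha> m u \<longrightarrow> \<chi> (transversal (\<lambda>p. F p (u p)) \<alpha>) = c)"
    if \<chi>: "\<forall>S. \<chi> S \<in> Q" for \<chi>
  proof -
    \<comment> \<open>A word of copies describes a transversal above \<alpha>: in part
      \<open>p\<close> it takes the word of the vertices \<open>e i p\<close>. Its colour becomes
      the colour of the word.\<close>
    define \<chi>' where "\<chi>' x = \<chi> (transversal (\<lambda>p. to_nat
       (Inl (map (\<lambda>i. e i p) x) :: nat list + nat option list \<times> nat)) \<alpha>)" for x
    have "\<forall>x. \<chi>' x \<in> Q" using \<chi> by (simp add: \<chi>'_def)
    then obtain W c where W: "combinatorial_line t N W" "\<forall>j<t. \<chi>' (line_point W j) = c"
      using N unfolding hales_jewett_dim_def by blast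
    have col: "\<chi> (transversal (\<lambda>p. line_vertex \<alpha> e W p (u p)) \<alpha>) = c"
      if u: "partite_copy k V l \<alpha> m u" for u
    proof -
      obtain j where j: "j < t" "restrict u \<alpha> = e j"
        using copy_restrict[OF u] eE by force
      have "line_vertex \<alpha> e W p (u p) = to_nat
           (Inl (map (\<lambda>i. e i p) (line_point W j)) :: nat list + nat option list \<times> nat)"
        if "p \<in> \<alpha>" for p
      proof -
        have "u p = e j p" using j(2) that by (metis restrict_apply')
        then show ?thesis
          using that by (auto simp: line_vertex_def line_point_def split: option.splits)
      qed
      then have "\<chi> (transversal (\<lambda>p. line_vertex \<alpha> e W p (u p)) \<alpha>) = \<chi>' (line_point W j)"
        unfolding \<chi>'_def by (intro arg_cong[of _ _ \<chi>] transversal_cong)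
      then show ?thesis using W(2) j(1) by simp
    qed
    moreover have "c \<in> Q" using True col \<chi> by metis
    moreover have "W \<in> Ls" using W(1) by (simp add: Ls_def)
    ultimately show ?thesis using emb by blast
  qed
  moreover have "finite V'"
    unfolding V'_def Ls_def using V finite_combinatorial_lines by blast
  ultimately show ?thesis by blast
qed

text \<open>The indices are treated one by one. For a given colouring the newest index is settled
  first, in \<open>V2\<close>; the colouring is then pulled back along \<open>G\<close> to
  \<open>V1\<close>, where the induction hypothesis settles the rest. As \<open>F\<close> maps
  copies to copies, the composite keeps what \<open>G\<close> achieved.\<close>

lemma partite_construction:
  assumes I: "finite I" and V: "finite V" and \<alpha>: "\<forall>i\<in>I. finite (\<alpha> i)" and Q: "finite (Q :: nat set)"
  shows "\<exists>V' l'. finite V' \<and>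
    (\<forall>\<chi>. (\<forall>S. \<chi> S \<in> Q) \<longrightarrow>
      (\<exists>F. partite_emb k V l V' l' F \<and>
        (\<forall>i\<in>I. \<exists>c\<in>Q. \<forall>u. partite_copy k V l (\<alpha> i) (m i) u \<longrightarrow>
           \<chi> (transversal (\<lambda>p. F p (u p)) (\<alpha> i)) = c)))"
  using I \<alpha>
proof (induction I)
  case empty
  then show ?case using partite_emb_id V by blast
next
  case (insert i I)
  then have fin: "finite (\<alpha> i)" "\<forall>i\<in>I. finite (\<alpha> i)" by simp_all
  obtain V1 l1 where 1: "finite V1" and V1: "\<forall>\<chi>. (\<forall>S. \<chi> S \<in> Q) \<longrightarrow>
      (\<exists>F. partite_emb k V l V1 l1 F \<and>
        (\<forall>i\<in>I. \<exists>c\<in>Q. \<forall>u. partite_copy k V l (\<alpha> i) (m i) u \<longrightarrow>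
           \<chi> (transversal (\<lambda>p. F p (u p)) (\<alpha> i)) = c))"
    using insert.IH[OF fin(2)] by (elim exE conjE)
  obtain V2 l2 where 2: "finite V2" and V2: "\<forall>\<chi>. (\<forall>S. \<chi> S \<in> Q) \<longrightarrow>
      (\<exists>F. partite_emb k V1 l1 V2 l2 F \<and>
        (\<exists>c\<in>Q. \<forall>u. partite_copy k V1 l1 (\<alpha> i) (m i) u \<longrightarrow>
           \<chi> (transversal (\<lambda>p. F p (u p)) (\<alpha> i)) = c))"
    using partite_lemma[OF 1 fin(1) Q, of k l1 "m i"] by (elim exE conjE)
  have "\<exists>F. partite_emb k V l V2 l2 F \<and>
        (\<forall>i\<in>insert i I. \<exists>c\<in>Q. \<forall>u. partite_copy k V l (\<alpha> i) (m i) u \<longrightarrow>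
           \<chi> (transversal (\<lambda>p. F p (u p)) (\<alpha> i)) = c)"
    if \<chi>: "\<forall>S. \<chi> S \<in> Q" for \<chi>
  proof -
    obtain G c where G: "partite_emb k V1 l1 V2 l2 G" "c \<in> Q"
        "\<And>u. partite_copy k V1 l1 (\<alpha> i) (m i) u \<Longrightarrow> \<chi> (transversal (\<lambda>p. G p (u p)) (\<alpha> i)) = c"
      using V2[THEN spec, THEN mp, OF \<chi>] by blast
    define \<chi>1 where "\<chi>1 S = \<chi> ((\<lambda>(p, y). (p, G p y)) ` S)" for S
    have \<chi>1: "\<chi>1 (transversal u T) = \<chi> (transversal (\<lambda>p. G p (u p)) T)" for u T
      unfolding \<chi>1_def transversal_def by (simp add: image_image)
    have "\<forall>S. \<chi>1 S \<in> Q" using \<chi> by (simp add: \<chi>1_def)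
    from V1[THEN spec, THEN mp, OF this] obtain F where F: "partite_emb k V l V1 l1 F"
       "\<forall>i\<in>I. \<exists>c\<in>Q. \<forall>u. partite_copy k V l (\<alpha> i) (m i) u \<longrightarrow>
           \<chi>1 (transversal (\<lambda>p. F p (u p)) (\<alpha> i)) = c"
      by blast
    have "\<forall>u. partite_copy k V l (\<alpha> i) (m i) u \<longrightarrow>
           \<chi> (transversal (\<lambda>p. G p (F p (u p))) (\<alpha> i)) = c"
      using G(3) partite_copy_emb[OF _ F(1)] by blast
    then show ?thesis
      using partite_emb_comp[OF F(1) G(1)] F(2) G(2)
      unfolding \<chi>1
      by (intro exI[of _ "\<lambda>p y. G p (F p y)"]) blast
  qed
  then show ?case using 2 by blast
qed

section \<open>Ramsey's theorem for products\<close>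

lemma ramsey_finite_colours:
  assumes "finite (Q :: nat set)"
  shows "\<exists>N::nat. \<forall>f. (\<forall>S. f S \<in> Q) \<longrightarrow> (\<exists>H\<in>nsets {..<N} b. \<exists>c\<in>Q. \<forall>S\<in>nsets H a. f S = c)"
proof -
  obtain h where h: "bij_betw h Q {..<card Q}"
    using ex_bij_betw_finite_nat[OF assms] by (metis atLeast0LessThan)
  obtain N where N: "partn_lst {..<N::nat} (replicate (card Q) b) a"
    using ramsey_full by blast
  have "\<exists>H\<in>nsets {..<N} b. \<exists>c\<in>Q. \<forall>S\<in>nsets H a. f S = c" if f: "\<forall>S. f S \<in> Q" for f
  proof -
    have "(\<lambda>S. h (f S)) \<in> nsets {..<N} a \<rightarrow> {..<card Q}"
      using f h by (auto simp: bij_betw_def)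
    then obtain i H where "i < card Q" "H \<in> nsets {..<N} (replicate (card Q) b ! i)"
        "(\<lambda>S. h (f S)) ` nsets H a \<subseteq> {i}"
      by (rule partn_lstE[OF N]) simp_all
    then have i: "i < card Q" "H \<in> nsets {..<N} b" "(\<lambda>S. h (f S)) ` nsets H a \<subseteq> {i}"
      by simp_all
    have "i \<in> h ` Q" using h i(1) by (simp add: bij_betw_def)
    then obtain c where c: "c \<in> Q" "h c = i" by blast
    have "f S = c" if "S \<in> nsets H a" for S
      using i(3) that c h f by (auto simp: bij_betw_def inj_on_def)
    with c(1) i(2) show ?thesis by blast
  qed
  then show ?thesis by blast
qed

text \<open>Each \<delta> is coloured by the vector of colours of all pairs with \<alpha> in
  \<open>nsets {..<N} a\<close>. On a \<gamma> homogeneous for these vectors the colour depends on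
  \<alpha> alone, and Ramsey's theorem applies on \<open>{..<N}\<close>. The bound \<open>L\<close>
  is chosen after \<open>N\<close>, since the number of vectors depends on \<open>N\<close>.\<close>

lemma product_ramsey:
  assumes Q: "finite (Q :: nat set)"
  shows "\<exists>(N::nat) (L::nat). \<forall>f. (\<forall>\<alpha> \<delta>. f \<alpha> \<delta> \<in> Q) \<longrightarrow>
    (\<exists>\<beta>\<in>nsets {..<N} b. \<exists>\<gamma>\<in>nsets {..<L} b'. \<exists>c\<in>Q. \<forall>\<alpha>\<in>nsets \<beta> a. \<forall>\<delta>\<in>nsets \<gamma> a'. f \<alpha> \<delta> = c)"
proof -
  obtain N :: nat where N: "\<And>f. (\<forall>S. f S \<in> Q) \<Longrightarrow> \<exists>H\<in>nsets {..<N} b. \<exists>c\<in>Q. \<forall>S\<in>nsets H a. f S = c"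
    using ramsey_finite_colours[OF Q] by metis
  obtain as where as: "set as = nsets {..<N} a"
    using finite_list[OF finite_imp_finite_nsets[of "{..<N}" a]] by auto
  define Q' where "Q' = to_nat ` {xs. set xs \<subseteq> Q \<and> length xs = length as}"
  have "finite Q'"
    unfolding Q'_def using Q by (intro finite_imageI finite_lists_length_eq)
  then obtain L :: nat where L: "\<And>f. (\<forall>S. f S \<in> Q') \<Longrightarrow> \<exists>H\<in>nsets {..<L} b'. \<exists>c\<in>Q'. \<forall>S\<in>nsets H a'. f S = c"
    using ramsey_finite_colours by metis
  have "\<exists>\<beta>\<in>nsets {..<N} b. \<exists>\<gamma>\<in>nsets {..<L} b'. \<exists>c\<in>Q. \<forall>\<alpha>\<in>nsets \<beta> a. \<forall>\<delta>\<in>nsets \<gamma> a'. f \<alpha> \<delta> = c"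
    if f: "\<forall>\<alpha> \<delta>. f \<alpha> \<delta> \<in> Q" for f
  proof -
    define g where "g \<delta> = to_nat (map (\<lambda>\<alpha>. f \<alpha> \<delta>) as)" for \<delta>
    have "\<forall>\<delta>. g \<delta> \<in> Q'" unfolding g_def Q'_def using f by (intro allI imageI) auto
    then obtain \<gamma> c where \<gamma>: "\<gamma> \<in> nsets {..<L} b'" "c \<in> Q'" "\<forall>\<delta>\<in>nsets \<gamma> a'. g \<delta> = c"
      using L by blast
    \<comment> \<open>If \<gamma> has no \<open>a'\<close>-subset nothing is required of
      \<open>h\<close>; the default keeps its values in \<open>Q\<close>.\<close>
    define h where "h \<alpha> = (if \<exists>\<delta>. \<delta> \<in> nsets \<gamma> a' then f \<alpha> (SOME \<delta>. \<delta> \<in> nsets \<gamma> a') else f \<alpha> {})" for \<alpha>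
    have h: "f \<alpha> \<delta> = h \<alpha>" if "\<alpha> \<in> nsets {..<N} a" "\<delta> \<in> nsets \<gamma> a'" for \<alpha> \<delta>
    proof -
      let ?\<delta> = "SOME \<delta>. \<delta> \<in> nsets \<gamma> a'"
      have "?\<delta> \<in> nsets \<gamma> a'" using that(2) by (rule someI)
      then have "g \<delta> = g ?\<delta>" using \<gamma>(3) that(2) by simp
      then have "f \<alpha> \<delta> = f \<alpha> ?\<delta>" using that(1) as by (simp add: g_def)
      then show ?thesis using that(2) by (auto simp: h_def)
    qed
    have "\<forall>\<alpha>. h \<alpha> \<in> Q" using f by (simp add: h_def)
    then obtain \<beta> d where \<beta>: "\<beta> \<in> nsets {..<N} b" "d \<in> Q" "\<forall>\<alpha>\<in>nsets \<beta> a. h \<alpha> = d"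
      using N by blast
    have "nsets \<beta> a \<subseteq> nsets {..<N} a"
      using \<beta>(1) by (intro nsets_mono) (simp add: nsets_def)
    then have "\<forall>\<alpha>\<in>nsets \<beta> a. \<forall>\<delta>\<in>nsets \<gamma> a'. f \<alpha> \<delta> = d"
      using \<beta>(3) h by (simp add: subset_iff)
    with \<beta>(1,2) \<gamma>(1) show ?thesis by blast
  qed
  then show ?thesis by blast
qed

section \<open>Isomorphisms of finite linear orders\<close>

definition order_rank :: "'a set \<Rightarrow> 'a rel \<Rightarrow> 'a \<Rightarrow> nat" where
  "order_rank X r x = card {y \<in> X. (y, x) \<in> r \<and> y \<noteq> x}"

lemma order_rank_less:
  assumes r: "linear_order_on X r" and X: "finite X" and "x \<in> X" "y \<in> X" "(x, y) \<in> r" "x \<noteq> y"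
  shows "order_rank X r x < order_rank X r y"
  unfolding order_rank_def
proof (rule psubset_card_mono)
  have "trans r" "antisym r"
    using r by (auto simp: order_on_defs)
  then have "{z \<in> X. (z, x) \<in> r \<and> z \<noteq> x} \<subseteq> {z \<in> X. (z, y) \<in> r \<and> z \<noteq> y}"
    using assms by (auto dest: transD antisymD)
  moreover have "x \<in> {z \<in> X. (z, y) \<in> r \<and> z \<noteq> y} - {z \<in> X. (z, x) \<in> r \<and> z \<noteq> x}"
    using assms by auto
  ultimately show "{z \<in> X. (z, x) \<in> r \<and> z \<noteq> x} \<subset> {z \<in> X. (z, y) \<in> r \<and> z \<noteq> y}"
    by blast
qed (use X in simp)

lemma bij_betw_order_rank:
  assumes r: "linear_order_on X r" and X: "finite X"
  shows "bij_betw (order_rank X r) X {..<card X}"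
proof -
  have tot: "total_on X r" using r by (simp add: order_on_defs)
  have inj: "inj_on (order_rank X r) X"
  proof (rule inj_onI, rule ccontr)
    fix x y assume xy: "x \<in> X" "y \<in> X" "order_rank X r x = order_rank X r y" "x \<noteq> y"
    then consider "(x, y) \<in> r" | "(y, x) \<in> r" using tot by (auto simp: total_on_def)
    then show False using order_rank_less[OF r X] xy by cases fastforce+
  qed
  have "order_rank X r x < card X" if "x \<in> X" for x
    unfolding order_rank_def using that X by (intro psubset_card_mono) auto
  then have "order_rank X r ` X \<subseteq> {..<card X}" by auto
  moreover have "card (order_rank X r ` X) = card {..<card X}"
    using inj by (simp add: card_image)
  ultimately show ?thesis
    using inj by (simp add: bij_betw_def card_subset_eq)
qed

definition le_on :: "nat set \<Rightarrow> nat rel" where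
  "le_on X = {(x, y). x \<in> X \<and> y \<in> X \<and> x \<le> y}"

lemma linear_order_le_on: "linear_order_on X (le_on X)"
  by (auto simp: order_on_defs le_on_def refl_on_def trans_def antisym_def total_on_def)

text \<open>For sets of equal finite size this is the order isomorphism onto \<alpha>, obtained by
  matching ranks.\<close>

definition order_iso :: "'a set \<Rightarrow> 'a rel \<Rightarrow> nat set \<Rightarrow> 'a \<Rightarrow> nat" where
  "order_iso X r \<alpha> x = inv_into \<alpha> (order_rank \<alpha> (le_on \<alpha>)) (order_rank X r x)"

lemma order_iso:
  assumes r: "linear_order_on X r" and X: "finite X" and \<alpha>: "finite \<alpha>" "card \<alpha> = card X"
  shows "bij_betw (order_iso X r \<alpha>) X \<alpha>"
    and "\<And>x y. \<lbrakk>x \<in> X; y \<in> X; (x, y) \<in> r\<rbrakk> \<Longrightarrow> order_iso X r \<alpha> x \<le> order_iso X r \<alpha> y"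
proof -
  note bX = bij_betw_order_rank[OF r X]
  note b\<alpha> = bij_betw_order_rank[OF linear_order_le_on \<alpha>(1), unfolded \<alpha>(2)]
  have comp: "order_iso X r \<alpha> = inv_into \<alpha> (order_rank \<alpha> (le_on \<alpha>)) \<circ> order_rank X r"
    by (auto simp: order_iso_def)
  show bij: "bij_betw (order_iso X r \<alpha>) X \<alpha>"
    unfolding comp using bX bij_betw_inv_into[OF b\<alpha>] by (rule bij_betw_trans)
  have rank: "order_rank \<alpha> (le_on \<alpha>) (order_iso X r \<alpha> x) = order_rank X r x" if "x \<in> X" for x
    unfolding order_iso_def using that bX b\<alpha>
    by (auto intro!: f_inv_into_f simp: bij_betw_def)
  fix x y assume xy: "x \<in> X" "y \<in> X" "(x, y) \<in> r"
  show "order_iso X r \<alpha> x \<le> order_iso X r \<alpha> y"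
  proof (rule ccontr)
    assume less: "\<not> ?thesis"
    have mem: "order_iso X r \<alpha> x \<in> \<alpha>" "order_iso X r \<alpha> y \<in> \<alpha>"
      using bij xy by (auto simp: bij_betw_def)
    have "order_rank X r y < order_rank X r x"
      using order_rank_less[OF linear_order_le_on \<alpha>(1) mem(2,1)] less mem xy rank
      by (auto simp: le_on_def)
    moreover have "order_rank X r x \<le> order_rank X r y"
      using order_rank_less[OF r X xy] by (cases "x = y") auto
    ultimately show False by simp
  qed
qed

text \<open>A monotone injection preserves ranks. This lets an arbitrary embedding be recognised as
  the canonical transport to its image.\<close>

lemma order_iso_unique:
  assumes r: "linear_order_on X r" and X: "finite X" and h: "inj_on h X"
    and mono: "\<And>x y. \<lbrakk>x \<in> X; y \<in> X; (x, y) \<in> r\<rbrakk> \<Longrightarrow> h x \<le> h y"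
    and x: "x \<in> X"
  shows "order_iso X r (h ` X) x = h x"
proof -
  have "{z \<in> h ` X. z \<le> h x \<and> z \<noteq> h x} = h ` {y \<in> X. (y, x) \<in> r \<and> y \<noteq> x}"
  proof -
    have "(y, x) \<in> r" if "y \<in> X" "h y \<le> h x" "h y \<noteq> h x" for y
    proof (rule ccontr)
      assume "(y, x) \<notin> r"
      then have "(x, y) \<in> r"
        using r that x by (auto simp: order_on_defs total_on_def)
      then show False using mono[of x y] that x by simp
    qed
    then show ?thesis
      using mono x h by (auto simp: inj_on_def)
  qed
  moreover have "inj_on h {y \<in> X. (y, x) \<in> r \<and> y \<noteq> x}"
    using h by (rule inj_on_subset) auto
  ultimately have "card {z \<in> h ` X. z \<le> h x \<and> z \<noteq> h x} = order_rank X r x"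
    by (simp add: card_image order_rank_def)
  moreover have "{z \<in> h ` X. z \<le> h x \<and> z \<noteq> h x} = {z \<in> h ` X. (z, h x) \<in> le_on (h ` X) \<and> z \<noteq> h x}"
    using x by (auto simp: le_on_def)
  ultimately have "order_rank (h ` X) (le_on (h ` X)) (h x) = order_rank X r x"
    by (simp add: order_rank_def)
  moreover have "inj_on (order_rank (h ` X) (le_on (h ` X))) (h ` X)"
    using bij_betw_order_rank[OF linear_order_le_on] X by (simp add: bij_betw_def)
  ultimately show ?thesis
    unfolding order_iso_def using x by (metis imageI inv_into_f_f)
qed

section \<open>From partite systems to labelled equivalences\<close>

text \<open>Each index gets its own second coordinate \<open>code j\<close>, so any vertex of a set
  reveals which structure the set belongs to. Here \<open>k > 0\<close> enters, as it makes
  \<open>k\<close>-sets nonempty.\<close>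

lemma disjoint_union_system:
  assumes J: "finite J" and \<beta>: "\<forall>j\<in>J. finite (\<beta> j)" and k: "k > 0"
  shows "\<exists>V l code. finite V \<and> (\<forall>j\<in>J. partite_copy k V l (\<beta> j) (m j) (\<lambda>_. code j))"
proof -
  obtain code :: "'a \<Rightarrow> nat" where code: "inj_on code J"
    using finite_imp_inj_to_nat_seg[OF J] by blast
  define V where "V = (\<Union>j\<in>J. (\<lambda>p. (p, code j)) ` \<beta> j)"
  define l where "l S = m (inv_into J code (snd (SOME x. x \<in> S))) (fst ` S)" for S
  have "partite_copy k V l (\<beta> j) (m j) (\<lambda>_. code j)" if j: "j \<in> J" for j
    unfolding partite_copy_def
  proof (intro conjI ballI)
    show "(p, code j) \<in> V" if "p \<in> \<beta> j" for p
      using that j by (auto simp: V_def)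
    fix T assume "T \<in> nsets (\<beta> j) k"
    then have "T \<noteq> {}" using k by (auto simp: nsets_def)
    then have "\<exists>x. x \<in> transversal (\<lambda>_. code j) T"
      by (auto simp: transversal_def)
    then have "(SOME x. x \<in> transversal (\<lambda>_. code j) T) \<in> transversal (\<lambda>_. code j) T"
      by (rule someI_ex)
    then have "snd (SOME x. x \<in> transversal (\<lambda>_. code j) T) = code j"
      by (auto simp: transversal_def)
    then show "l (transversal (\<lambda>_. code j) T) = m j T"
      using code j by (simp add: l_def)
  qed
  moreover have "finite V" using J \<beta> by (simp add: V_def)
  ultimately show ?thesis by blast
qed

section \<open>Transport of a structure to prescribed vertex and label sets\<close>

definition vertex_iso :: "'a lequiv \<Rightarrow> nat set \<Rightarrow> 'a \<Rightarrow> nat" where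
  "vertex_iso A = order_iso (carrier A) (ordering A)"

definition label_iso :: "nat \<Rightarrow> 'a lequiv \<Rightarrow> nat set \<Rightarrow> nat \<Rightarrow> nat" where
  "label_iso k A = order_iso (label_range k A) (le_on (label_range k A))"

text \<open>The labelling of \<open>A\<close> transported to the vertex set \<alpha> and the label
  set \<delta>; it becomes the pattern \<open>m\<close> of \<open>partite_copy\<close>.\<close>

definition relabel :: "nat \<Rightarrow> 'a lequiv \<Rightarrow> nat set \<Rightarrow> nat set \<Rightarrow> nat set \<Rightarrow> nat" where
  "relabel k A \<alpha> \<delta> T = label_iso k A \<delta> (label A (inv_into (carrier A) (vertex_iso A \<alpha>) ` T))"

lemma LEQ_finite:
  assumes "A \<in> LEQ k"
  shows "finite (carrier A)" "finite (label_range k A)" "linear_order_on (carrier A) (ordering A)"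
  using assms by (auto simp: LEQ_def labelled_equiv_def label_range_def finite_imp_finite_nsets)

lemma vertex_iso:
  assumes "A \<in> LEQ k" "\<alpha> \<in> nsets X (card (carrier A))"
  shows "bij_betw (vertex_iso A \<alpha>) (carrier A) \<alpha>"
    and "\<And>x y. \<lbrakk>x \<in> carrier A; y \<in> carrier A; (x, y) \<in> ordering A\<rbrakk> \<Longrightarrow> vertex_iso A \<alpha> x \<le> vertex_iso A \<alpha> y"
  unfolding vertex_iso_def
  using order_iso[OF LEQ_finite(3)[OF assms(1)] LEQ_finite(1)[OF assms(1)], of \<alpha>] assms(2)
  by (auto simp: nsets_def)

lemma label_iso:
  assumes "A \<in> LEQ k" "\<delta> \<in> nsets X (card (label_range k A))"
  shows "bij_betw (label_iso k A \<delta>) (label_range k A) \<delta>"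
    and "mono_on (label_range k A) (label_iso k A \<delta>)"
  unfolding label_iso_def mono_on_def
  using order_iso[OF linear_order_le_on LEQ_finite(2)[OF assms(1)], of \<delta>] assms(2)
  by (auto simp: nsets_def le_on_def)

lemma relabel_image:
  assumes "A \<in> LEQ k" "\<alpha> \<in> nsets X (card (carrier A))" "M \<subseteq> carrier A"
  shows "relabel k A \<alpha> \<delta> (vertex_iso A \<alpha> ` M) = label_iso k A \<delta> (label A M)"
  using vertex_iso(1)[OF assms(1,2)] assms(3)
  by (simp add: relabel_def bij_betw_def inv_into_image_cancel)

lemma relabel_mem:
  assumes A: "A \<in> LEQ k" and \<alpha>: "\<alpha> \<in> nsets X (card (carrier A))"
    and \<delta>: "\<delta> \<in> nsets Y (card (label_range k A))" and T: "T \<in> nsets \<alpha> k"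
  shows "relabel k A \<alpha> \<delta> T \<in> \<delta>"
proof -
  have "bij_betw (inv_into (carrier A) (vertex_iso A \<alpha>)) \<alpha> (carrier A)"
    using vertex_iso(1)[OF A \<alpha>] by (rule bij_betw_inv_into)
  then have "inv_into (carrier A) (vertex_iso A \<alpha>) ` T \<in> nsets (carrier A) k"
    using T by (metis bij_betw_nsets bij_betw_apply)
  then show ?thesis
    using label_iso(1)[OF A \<delta>] by (auto simp: relabel_def label_range_def bij_betw_def)
qed

section \<open>Labelled equivalences obtained from partite systems\<close>

definition lex_le :: "nat \<times> nat \<Rightarrow> nat \<times> nat \<Rightarrow> bool" where
  "lex_le x y \<longleftrightarrow> fst x < fst y \<or> fst x = fst y \<and> snd x \<le> snd y"

text \<open>The injection \<phi> carries the vertices into the type of the class. The labels are the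
  very numbers given by \<open>l\<close>.\<close>

definition host ::
  "nat \<Rightarrow> (nat \<times> nat \<Rightarrow> 'a) \<Rightarrow> (nat \<times> nat) set \<Rightarrow> ((nat \<times> nat) set \<Rightarrow> nat) \<Rightarrow> 'a lequiv"
where
  "host k \<phi> V l =
     \<lparr>carrier = \<phi> ` V,
      ordering = {(\<phi> x, \<phi> y) | x y. x \<in> V \<and> y \<in> V \<and> lex_le x y},
      label = restrict (\<lambda>M. l (inv \<phi> ` M)) (nsets (\<phi> ` V) k)\<rparr>"

lemma host_ordering:
  assumes "inj \<phi>"
  shows "(\<phi> x, \<phi> y) \<in> ordering (host k \<phi> V l) \<longleftrightarrow> x \<in> V \<and> y \<in> V \<and> lex_le x y"
  using assms by (cases x; cases y) (auto simp: host_def inj_eq)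

lemma host_label:
  assumes "inj \<phi>" "S \<in> nsets V k"
  shows "label (host k \<phi> V l) (\<phi> ` S) = l S"
proof -
  have "\<phi> ` S \<in> nsets (\<phi> ` V) k"
    using assms by (auto simp: nsets_def card_image inj_on_subset)
  then show ?thesis
    using assms by (simp add: host_def inv_f_f image_image)
qed

lemma host_LEQ:
  assumes "inj \<phi>" "finite V"
  shows "host k \<phi> V l \<in> LEQ k"
proof -
  have "linear_order_on (\<phi> ` V) (ordering (host k \<phi> V l))"
    unfolding order_on_defs
  proof (intro conjI)
    show "refl_on (\<phi> ` V) (ordering (host k \<phi> V l))"
      using assms(1) by (auto simp: refl_on_def host_ordering lex_le_def)
    show "ordering (host k \<phi> V l) \<subseteq> \<phi> ` V \<times> \<phi> ` V"
      by (auto simp: host_def)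
    show "trans (ordering (host k \<phi> V l))"
      using assms(1) by (auto simp: trans_def host_def inj_eq lex_le_def)
    show "antisym (ordering (host k \<phi> V l))"
      using assms(1) by (auto simp: antisym_def host_def inj_eq lex_le_def)
    show "total_on (\<phi> ` V) (ordering (host k \<phi> V l))"
      using assms(1) by (auto simp: total_on_def host_ordering lex_le_def)
  qed
  then show ?thesis
    using assms(2) by (auto simp: LEQ_def labelled_equiv_def host_def)
qed

lemma transversal_nsets:
  assumes "T \<in> nsets \<beta> k" "\<forall>p\<in>\<beta>. (p, u p) \<in> V"
  shows "transversal u T \<in> nsets V k"
proof -
  have "inj_on (\<lambda>p. (p, u p)) T" by (auto simp: inj_on_def)
  then show ?thesis
    using assms by (auto simp: nsets_def transversal_def card_image)
qed

text \<open>The copy carries exactly the labels prescribed by \<open>relabel\<close>, so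
  \<open>label_iso k B \<gamma>\<close> is itself the required map of labels. Monotonicity needs
  only the order of the parts, which \<open>vertex_iso\<close> respects.\<close>

lemma embedding_of_partite_copy:
  fixes \<phi> :: "nat \<times> nat \<Rightarrow> 'b"
  assumes B: "B \<in> LEQ k" and \<phi>: "inj \<phi>"
    and \<beta>: "\<beta> \<in> nsets X (card (carrier B))" and \<gamma>: "\<gamma> \<in> nsets Y (card (label_range k B))"
    and w: "partite_copy k V l \<beta> (relabel k B \<beta> \<gamma>) w"
  defines "f \<equiv> \<lambda>x. \<phi> (vertex_iso B \<beta> x, w (vertex_iso B \<beta> x))"
  shows "embedding k B (host k \<phi> V l) f" and "f ` carrier B = \<phi> ` transversal w \<beta>"
proof -
  let ?h = "vertex_iso B \<beta>"
  note bij = vertex_iso(1)[OF B \<beta>] and mono = vertex_iso(2)[OF B \<beta>]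
  have inj: "inj_on ?h (carrier B)" and img: "?h ` carrier B = \<beta>"
    using bij by (auto simp: bij_betw_def)
  have V: "\<forall>p\<in>\<beta>. (p, w p) \<in> V" using w by (simp add: partite_copy_def)
  have hV: "(?h x, w (?h x)) \<in> V" if "x \<in> carrier B" for x
    using V img that by blast
  have lab: "label_iso k B \<gamma> (label B M) = label (host k \<phi> V l) (f ` M)"
    and memb: "f ` M \<in> nsets (\<phi> ` V) k"
    if M: "M \<in> nsets (carrier B) k" for M
  proof -
    have T: "?h ` M \<in> nsets \<beta> k"
      using bij_betw_nsets[OF bij] M by (metis bij_betw_apply)
    have fM: "f ` M = \<phi> ` transversal w (?h ` M)"
      by (simp add: f_def transversal_def image_image)
    have "label (host k \<phi> V l) (f ` M) = l (transversal w (?h ` M))"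
      unfolding fM by (rule host_label[OF \<phi> transversal_nsets[OF T V]])
    also have "\<dots> = relabel k B \<beta> \<gamma> (?h ` M)"
      using w T by (simp add: partite_copy_def)
    also have "\<dots> = label_iso k B \<gamma> (label B M)"
      using relabel_image[OF B \<beta>] M by (simp add: nsets_def)
    finally show "label_iso k B \<gamma> (label B M) = label (host k \<phi> V l) (f ` M)" ..
    show "f ` M \<in> nsets (\<phi> ` V) k"
      unfolding fM using transversal_nsets[OF T V] \<phi>
      by (auto simp: nsets_def card_image inj_on_subset)
  qed
  show "embedding k B (host k \<phi> V l) f"
    unfolding embedding_def
  proof (intro conjI ballI impI exI)
    show "f \<in> carrier B \<rightarrow> carrier (host k \<phi> V l)"
      using hV by (auto simp: f_def host_def)
    show "inj_on f (carrier B)"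
      using inj \<phi> by (auto simp: f_def inj_on_def)
    show "(f x, f y) \<in> ordering (host k \<phi> V l)"
      if "x \<in> carrier B" "y \<in> carrier B" "(x, y) \<in> ordering B" for x y
      using mono[OF that] hV that
      by (auto simp: f_def host_ordering[OF \<phi>] lex_le_def)
    show "label_iso k B \<gamma> \<in> label_range k B \<rightarrow> label_range k (host k \<phi> V l)"
    proof
      fix n assume "n \<in> label_range k B"
      then obtain M where "M \<in> nsets (carrier B) k" "n = label B M"
        by (auto simp: label_range_def)
      then show "label_iso k B \<gamma> n \<in> label_range k (host k \<phi> V l)"
        using lab memb by (simp add: label_range_def host_def)
    qed
    show "inj_on (label_iso k B \<gamma>) (label_range k B)"
      using label_iso(1)[OF B \<gamma>] by (simp add: bij_betw_def)
    show "mono_on (label_range k B) (label_iso k B \<gamma>)"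
      by (rule label_iso(2)[OF B \<gamma>])
  qed (rule lab)
  have "f ` carrier B = \<phi> ` transversal w (?h ` carrier B)"
    by (simp add: f_def transversal_def image_image)
  then show "f ` carrier B = \<phi> ` transversal w \<beta>"
    by (simp add: img)
qed

text \<open>The parts that are met form \<alpha> and the labels that occur form \<delta>; by
  \<open>order_iso_unique\<close> the embedding is the canonical transport for this pair. The
  inclusion of \<delta> in \<gamma> holds because \<open>k\<close>-subsets of the copy of
  \<open>B\<close> have labels in \<gamma>.\<close>

lemma partite_copy_of_embedding:
  fixes \<phi> :: "nat \<times> nat \<Rightarrow> 'b"
  assumes A: "A \<in> LEQ k" and B: "B \<in> LEQ k" and \<phi>: "inj \<phi>"
    and \<beta>: "\<beta> \<in> nsets X (card (carrier B))" and \<gamma>: "\<gamma> \<in> nsets Y (card (label_range k B))"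
    and w: "partite_copy k V l \<beta> (relabel k B \<beta> \<gamma>) w"
    and e: "embedding k A (host k \<phi> V l) e" and sub: "e ` carrier A \<subseteq> \<phi> ` transversal w \<beta>"
  shows "\<exists>\<alpha>\<in>nsets \<beta> (card (carrier A)). \<exists>\<delta>\<in>nsets \<gamma> (card (label_range k A)).
     partite_copy k V l \<alpha> (relabel k A \<alpha> \<delta>) w \<and> e ` carrier A = \<phi> ` transversal w \<alpha>"
proof -
  note finA = LEQ_finite[OF A]
  have V: "\<forall>p\<in>\<beta>. (p, w p) \<in> V" using w by (simp add: partite_copy_def)
  \<comment> \<open>The part containing \<open>e x\<close>; on a transversal the part determines the
    vertex.\<close>
  define h where "h x = fst (inv \<phi> (e x))" for x
  have h: "h x \<in> \<beta>" "e x = \<phi> (h x, w (h x))" if "x \<in> carrier A" for x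
  proof -
    obtain p where "p \<in> \<beta>" "e x = \<phi> (p, w p)"
      using sub \<open>x \<in> carrier A\<close> by (auto simp: transversal_def)
    then show "h x \<in> \<beta>" "e x = \<phi> (h x, w (h x))"
      using \<phi> by (simp_all add: h_def)
  qed
  have e_inj: "inj_on e (carrier A)"
    and e_mono: "\<And>x y. \<lbrakk>x \<in> carrier A; y \<in> carrier A; (x, y) \<in> ordering A\<rbrakk> \<Longrightarrow>
        (e x, e y) \<in> ordering (host k \<phi> V l)"
    using e by (auto simp: embedding_def)
  obtain \<iota> where \<iota>: "inj_on \<iota> (label_range k A)" "mono_on (label_range k A) \<iota>"
      "\<And>M. M \<in> nsets (carrier A) k \<Longrightarrow> \<iota> (label A M) = label (host k \<phi> V l) (e ` M)"
    using e by (auto simp: embedding_def)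
  have h_inj: "inj_on h (carrier A)"
    using e_inj h(2) by (metis inj_on_def)
  have h_mono: "h x \<le> h y" if "x \<in> carrier A" "y \<in> carrier A" "(x, y) \<in> ordering A" for x y
    using e_mono[OF that] h(2) that by (auto simp: host_ordering[OF \<phi>] lex_le_def)
  define \<alpha> where "\<alpha> = h ` carrier A"
  define \<delta> where "\<delta> = \<iota> ` label_range k A"
  have e_img: "e ` M = \<phi> ` transversal w (h ` M)" if "M \<subseteq> carrier A" for M
    using h(2) that by (force simp: transversal_def image_image subset_iff intro!: image_cong)
  have hM: "h ` M \<in> nsets \<beta> k" if "M \<in> nsets (carrier A) k" for M
  proof -
    have "inj_on h M" using h_inj that by (auto simp: nsets_def intro: inj_on_subset)
    then show ?thesis using that h(1) by (auto simp: nsets_def card_image)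
  qed
  have \<iota>_lab: "\<iota> (label A M) = l (transversal w (h ` M))" if M: "M \<in> nsets (carrier A) k" for M
  proof -
    have "\<iota> (label A M) = label (host k \<phi> V l) (\<phi> ` transversal w (h ` M))"
      using \<iota>(3)[OF M] e_img M by (simp add: nsets_def)
    then show ?thesis
      using host_label[OF \<phi> transversal_nsets[OF hM[OF M] V]] by simp
  qed
  have \<alpha>: "\<alpha> \<in> nsets \<beta> (card (carrier A))"
    using h(1) h_inj finA(1) by (auto simp: \<alpha>_def nsets_def card_image)
  have "\<iota> (label A M) \<in> \<gamma>" if M: "M \<in> nsets (carrier A) k" for M
    using relabel_mem[OF B \<beta> \<gamma> hM[OF M]] w hM[OF M] \<iota>_lab[OF M] by (simp add: partite_copy_def)
  then have \<delta>: "\<delta> \<in> nsets \<gamma> (card (label_range k A))"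
    using \<iota>(1) finA(2) by (auto simp: \<delta>_def nsets_def card_image label_range_def)
  have vertex: "vertex_iso A \<alpha> x = h x" if "x \<in> carrier A" for x
    unfolding vertex_iso_def \<alpha>_def
    using order_iso_unique[OF finA(3,1) h_inj h_mono that] .
  have lbl: "label_iso k A \<delta> n = \<iota> n" if "n \<in> label_range k A" for n
    unfolding label_iso_def \<delta>_def
    using \<iota>(2) by (intro order_iso_unique[OF linear_order_le_on finA(2) \<iota>(1) _ that])
       (auto simp: le_on_def mono_on_def)
  have "l (transversal w T) = relabel k A \<alpha> \<delta> T" if T: "T \<in> nsets \<alpha> k" for T
  proof -
    have "bij_betw h (carrier A) \<alpha>" using h_inj by (simp add: bij_betw_def \<alpha>_def)
    then have "nsets \<alpha> k = (`) h ` nsets (carrier A) k"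
      using bij_betw_nsets by (metis bij_betw_def)
    then obtain M where M: "M \<in> nsets (carrier A) k" "T = h ` M"
      using T by blast
    then have Mc: "M \<subseteq> carrier A" by (simp add: nsets_def)
    then have "vertex_iso A \<alpha> ` M = T"
      unfolding M(2) using vertex by (intro image_cong) auto
    then have "relabel k A \<alpha> \<delta> T = label_iso k A \<delta> (label A M)"
      using relabel_image[OF A \<alpha> Mc] by simp
    also have "\<dots> = \<iota> (label A M)"
      using lbl M(1) by (simp add: label_range_def)
    finally show ?thesis using \<iota>_lab[OF M(1)] M(2) by simp
  qed
  then have "partite_copy k V l \<alpha> (relabel k A \<alpha> \<delta>) w"
    using V \<alpha> by (auto simp: partite_copy_def nsets_def)
  moreover have "e ` carrier A = \<phi> ` transversal w \<alpha>"
    using e_img[of "carrier A"] by (simp add: \<alpha>_def)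
  ultimately show ?thesis using \<alpha> \<delta> by blast
qed

text \<open>Copies of \<open>A\<close> found inside a copy of \<open>B\<close> are, as records,
  copies of \<open>A\<close> in \<open>C\<close>, so the partition of the latter applies to
  them.\<close>

lemma embedding_substructure:
  assumes "S \<subseteq> carrier C" "embedding k A (substructure k C S) e"
  shows "embedding k A C e"
    and "substructure k (substructure k C S) (e ` carrier A) = substructure k C (e ` carrier A)"
    and "e ` carrier A \<subseteq> S"
proof -
  let ?D = "substructure k C S"
  have S: "carrier ?D = S" "ordering ?D \<subseteq> ordering C"
    and lab: "\<And>M. M \<in> nsets S k \<Longrightarrow> label ?D M = label C M"
    by (auto simp: substructure_def)
  show sub: "e ` carrier A \<subseteq> S"
    using assms(2) S(1) by (auto simp: embedding_def)
  have sets: "nsets S k \<subseteq> nsets (carrier C) k" "nsets (e ` carrier A) k \<subseteq> nsets S k"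
    using assms(1) sub by (auto intro!: nsets_mono)
  have rng: "label_range k ?D \<subseteq> label_range k C"
    using sets lab S(1) by (auto simp: label_range_def)
  have inj: "inj_on e (carrier A)" using assms(2) by (simp add: embedding_def)
  have img: "e ` M \<in> nsets S k" if "M \<in> nsets (carrier A) k" for M
  proof -
    have "inj_on e M" using inj that by (auto simp: nsets_def intro: inj_on_subset)
    then show ?thesis using that sub by (auto simp: nsets_def card_image)
  qed
  obtain \<iota> where "\<iota> \<in> label_range k A \<rightarrow> label_range k ?D"
     "inj_on \<iota> (label_range k A)" "mono_on (label_range k A) \<iota>"
     "\<forall>M\<in>nsets (carrier A) k. \<iota> (label A M) = label ?D (e ` M)"
    using assms(2) by (auto simp: embedding_def)
  then have "\<iota> \<in> label_range k A \<rightarrow> label_range k C"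
     "inj_on \<iota> (label_range k A)" "mono_on (label_range k A) \<iota>"
     "\<forall>M\<in>nsets (carrier A) k. \<iota> (label A M) = label C (e ` M)"
    using rng lab img by auto
  moreover have "e \<in> carrier A \<rightarrow> carrier C" using sub assms(1) by auto
  moreover have "\<forall>x\<in>carrier A. \<forall>y\<in>carrier A. (x, y) \<in> ordering A \<longrightarrow> (e x, e y) \<in> ordering C"
    using assms(2) S(2) unfolding embedding_def by blast
  ultimately show "embedding k A C e"
    using inj unfolding embedding_def by blast
  have "restrict (label ?D) (nsets (e ` carrier A) k) = restrict (label C) (nsets (e ` carrier A) k)"
    using lab sets(2) by (intro restrict_ext) auto
  then show "substructure k ?D (e ` carrier A) = substructure k C (e ` carrier A)"
    using sub by (auto simp: substructure_def)
qed

theorem theorem4p1: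
  fixes k :: nat
  assumes "k > 0"
  shows "ramsey_class (copies k) (LEQ k :: 'a::infinite lequiv set)"
  unfolding ramsey_class_def
proof (intro ballI allI impI)
  fix A B :: "'a lequiv" and r :: nat
  assume A: "A \<in> LEQ k" and B: "B \<in> LEQ k" and r: "r > 0"
  let ?a = "card (carrier A)" and ?b = "card (carrier B)"
  let ?a' = "card (label_range k A)" and ?b' = "card (label_range k B)"
  obtain \<psi> :: "nat \<Rightarrow> 'a" where \<psi>: "inj \<psi>"
    using arb_countable_map[of "{}"] by auto
  define \<phi> where "\<phi> = \<psi> \<circ> prod_encode"
  have \<phi>: "inj \<phi>"
    unfolding \<phi>_def using \<psi> inj_prod_encode by (rule inj_compose)
  have Q: "finite {..<r}" by simp
  obtain N L :: nat where NL: "\<forall>f. (\<forall>\<alpha> \<delta>. f \<alpha> \<delta> \<in> {..<r}) \<longrightarrow>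
    (\<exists>\<beta>\<in>nsets {..<N} ?b. \<exists>\<gamma>\<in>nsets {..<L} ?b'. \<exists>c\<in>{..<r}.
        \<forall>\<alpha>\<in>nsets \<beta> ?a. \<forall>\<delta>\<in>nsets \<gamma> ?a'. f \<alpha> \<delta> = c)"
    using product_ramsey[OF Q, of ?b ?b' ?a ?a'] by (elim exE)
  define I where "I = nsets {..<N} ?a \<times> nsets {..<L} ?a'"
  define J where "J = nsets {..<N} ?b \<times> nsets {..<L} ?b'"
  have "finite I" "finite J"
    by (simp_all add: I_def J_def finite_imp_finite_nsets)
  have "\<forall>j\<in>J. finite (fst j)"
    by (auto simp: J_def nsets_def)
  \<comment> \<open>A copy of \<open>B\<close> is provided for every pair in \<open>J\<close>, since
    the pair that will serve is known only after the colouring.\<close>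
  from disjoint_union_system[where \<beta> = fst and m = "\<lambda>j. relabel k B (fst j) (snd j)",
      OF \<open>finite J\<close> this assms]
  obtain V l code where V: "finite V"
     "\<forall>j\<in>J. partite_copy k V l (fst j) (relabel k B (fst j) (snd j)) (\<lambda>_. code j)"
    by (elim exE conjE)
  have "\<forall>i\<in>I. finite (fst i)"
    by (auto simp: I_def nsets_def)
  from partite_construction[where \<alpha> = fst and m = "\<lambda>i. relabel k A (fst i) (snd i)",
      OF \<open>finite I\<close> V(1) this Q, of k l]
  obtain V' l' where V': "finite V'" "\<forall>\<chi>. (\<forall>S. \<chi> S \<in> {..<r}) \<longrightarrow>
      (\<exists>F. partite_emb k V l V' l' F \<and>
        (\<forall>i\<in>I. \<exists>c\<in>{..<r}. \<forall>u. partite_copy k V l (fst i) (relabel k A (fst i) (snd i)) u \<longrightarrow>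
           \<chi> (transversal (\<lambda>p. F p (u p)) (fst i)) = c))"
    by (elim exE conjE)
  define C where "C = host k \<phi> V' l'"
  have "\<forall>P. disjoint_family_on P {..<r} \<and> (\<Union>i<r. P i) = copies k C A \<longrightarrow>
      (\<exists>B'\<in>copies k C B. \<exists>i<r. copies k B' A \<subseteq> P i)"
  proof (intro allI impI)
    fix P :: "nat \<Rightarrow> 'a lequiv set"
    assume P: "disjoint_family_on P {..<r} \<and> (\<Union>i<r. P i) = copies k C A"
    \<comment> \<open>The colour of a vertex set is the class of the structure it carries. Sets
      outside all classes get 0, a legal colour because \<open>r > 0\<close>.\<close>
    define \<chi> where "\<chi> S = (if \<exists>i<r. substructure k C (\<phi> ` S) \<in> P i
        then SOME i. i < r \<and> substructure k C (\<phi> ` S) \<in> P i else 0)" for S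
    have \<chi>: "\<chi> S < r \<and> substructure k C (\<phi> ` S) \<in> P (\<chi> S)"
      if "\<exists>i<r. substructure k C (\<phi> ` S) \<in> P i" for S
      using someI_ex[OF that] that by (simp add: \<chi>_def)
    have "\<forall>S. \<chi> S \<in> {..<r}"
      using \<chi> r by (metis \<chi>_def lessThan_iff)
    from V'(2)[THEN spec, THEN mp, OF this] obtain F where F: "partite_emb k V l V' l' F"
      "\<forall>i\<in>I. \<exists>c\<in>{..<r}. \<forall>u. partite_copy k V l (fst i) (relabel k A (fst i) (snd i)) u \<longrightarrow>
           \<chi> (transversal (\<lambda>p. F p (u p)) (fst i)) = c"
      by (elim exE conjE)
    from bchoice[OF F(2)[unfolded Bex_def]] obtain g where g: "\<And>i. i \<in> I \<Longrightarrow> g i < r"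
      "\<And>i u. i \<in> I \<Longrightarrow> partite_copy k V l (fst i) (relabel k A (fst i) (snd i)) u \<Longrightarrow>
           \<chi> (transversal (\<lambda>p. F p (u p)) (fst i)) = g i"
      by (auto simp: lessThan_iff)
    \<comment> \<open>The colours attached to the pairs form a colouring of pairs, to which the
      product theorem applies.\<close>
    define f where "f \<alpha> \<delta> = (if (\<alpha>, \<delta>) \<in> I then g (\<alpha>, \<delta>) else 0)" for \<alpha> \<delta>
    have "\<forall>\<alpha> \<delta>. f \<alpha> \<delta> \<in> {..<r}"
      using g(1) r by (simp add: f_def)
    from NL[THEN spec, THEN mp, OF this] obtain \<beta> \<gamma> c where
      \<beta>: "\<beta> \<in> nsets {..<N} ?b" and \<gamma>: "\<gamma> \<in> nsets {..<L} ?b'" and c: "c < r"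
      "\<forall>\<alpha>\<in>nsets \<beta> ?a. \<forall>\<delta>\<in>nsets \<gamma> ?a'. f \<alpha> \<delta> = c"
      by (elim bexE) (simp add: lessThan_iff)
    \<comment> \<open>The copy of \<open>B\<close> with index \<open>(\<beta>, \<gamma>)\<close> in
      the initial system; \<open>w\<close> is its image in the final one.\<close>
    define w0 where "w0 = (\<lambda>p::nat. code (\<beta>, \<gamma>))"
    define w where "w p = F p (w0 p)" for p
    have "(\<beta>, \<gamma>) \<in> J" using \<beta> \<gamma> by (simp add: J_def)
    with V(2) have w0: "partite_copy k V l \<beta> (relabel k B \<beta> \<gamma>) w0"
      by (auto simp: w0_def)
    then have w: "partite_copy k V' l' \<beta> (relabel k B \<beta> \<gamma>) w"
      unfolding w_def using F(1) by (rule partite_copy_emb)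
    define S where "S = \<phi> ` transversal w \<beta>"
    define B' where "B' = substructure k C S"
    have "B' \<in> copies k C B"
      using embedding_of_partite_copy[OF B \<phi> \<beta> \<gamma> w]
      unfolding copies_def B'_def S_def C_def by (metis (mono_tags, lifting) mem_Collect_eq)
    moreover have "copies k B' A \<subseteq> P c"
    proof
      fix D assume "D \<in> copies k B' A"
      then obtain e where e: "embedding k A B' e" "D = substructure k B' (e ` carrier A)"
        by (auto simp: copies_def)
      have SC: "S \<subseteq> carrier C"
        using w by (auto simp: S_def C_def host_def transversal_def partite_copy_def)
      note eC = embedding_substructure[OF SC e(1)[unfolded B'_def]]
      have D: "D = substructure k C (e ` carrier A)" "D \<in> copies k C A"
        using e(2) eC(1,2) by (auto simp: B'_def copies_def)
      from partite_copy_of_embedding[OF A B \<phi> \<beta> \<gamma> w eC(1)[unfolded C_def] eC(3)[unfolded S_def]]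
      obtain \<alpha> \<delta> where \<alpha>: "\<alpha> \<in> nsets \<beta> ?a" and \<delta>: "\<delta> \<in> nsets \<gamma> ?a'"
        and copy: "partite_copy k V' l' \<alpha> (relabel k A \<alpha> \<delta>) w"
        and img: "e ` carrier A = \<phi> ` transversal w \<alpha>"
        by blast
      have "\<forall>p\<in>\<alpha>. (p, w0 p) \<in> V"
        using w0 \<alpha> by (auto simp: partite_copy_def nsets_def)
      \<comment> \<open>Pulled back along \<open>F\<close>, the copy of \<open>A\<close> is one of
        those for which \<open>g\<close> gives the colour.\<close>
      then have copy0: "partite_copy k V l \<alpha> (relabel k A \<alpha> \<delta>) w0"
        using copy partite_copy_emb_iff[OF _ F(1)] unfolding w_def by blast
      have I: "(\<alpha>, \<delta>) \<in> I"
        using \<alpha> \<delta> \<beta> \<gamma> by (auto simp: I_def nsets_def)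
      then have "\<chi> (transversal w \<alpha>) = g (\<alpha>, \<delta>)"
        using g(2)[OF I] copy0 unfolding w_def by simp
      also have "\<dots> = c"
      proof -
        have "f \<alpha> \<delta> = c" using c(2) \<alpha> \<delta> by blast
        then show ?thesis using I by (simp add: f_def)
      qed
      finally have col: "\<chi> (transversal w \<alpha>) = c" .
      have "\<exists>i<r. substructure k C (\<phi> ` transversal w \<alpha>) \<in> P i"
        using P D img by auto
      then show "D \<in> P c"
        using \<chi> col D(1) img by metis
    qed
    ultimately show "\<exists>B'\<in>copies k C B. \<exists>i<r. copies k B' A \<subseteq> P i"
      using c(1) by blast
  qed
  moreover have "C \<in> LEQ k"
    unfolding C_def using \<phi> V'(1) by (rule host_LEQ)
  ultimately show "\<exists>C\<in>(LEQ k :: 'a lequiv set). \<forall>P. disjoint_family_on P {..<r} \<and> (\<Union>i<r. P i) = copies k C A \<longrightarrow>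
      (\<exists>B'\<in>copies k C B. \<exists>i<r. copies k B' A \<subseteq> P i)"
    by blast
qed

end
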